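(* For $d\in(0,1)$ let $s_1=s_1(d)$ be the unique solution in $[0,1]$ of $$2^d=\frac{2^{s_1}}{\mathbb{E}(W^{s_1})}\quad\Longleftrightarrow\quad d=s_1-\log_2\mathbb{E}(W^{s_1}),$$ and let $$s_2=s_2(d)=\frac{d}{1-\mathbb{E}(\log_2W)}\quad\Longleftrightarrow\quad d=s_2-\mathbb{E}(\log_2W^{s_2}).$$ Then $s_1/s_2\to1$ as $d\to0$.
   Context: $W$ is a positive random variable, not almost surely constant, with $\mathbb{E}(W)=1$ and $\mathbb{E}(W\log_2W)<1$ (the subcritical regime, assumed unless otherwise noted), and $\mathbb{E}(\log_2W)$ is finite. The function $s\mapsto2^s/\mathbb{E}(W^s)$ is continuous and strictly increasing from $[0,1]$ onto $[1,2]$. *)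

theory Defs
  imports "HOL-Probability.Probability"
begin

definition s1 :: "'a measure \<Rightarrow> ('a \<Rightarrow> real) \<Rightarrow> real \<Rightarrow> real" where
  "s1 M W d =
    (THE s. s \<in> {0..1} \<and> 2 powr d = 2 powr s / (\<integral>x. W x powr s \<partial>M))"

definition s2 :: "'a measure \<Rightarrow> ('a \<Rightarrow> real) \<Rightarrow> real \<Rightarrow> real" where
  "s2 M W d = d / (1 - (\<integral>x. log 2 (W x) \<partial>M))"

end

theory Submission
  imports Defs
begin

text \<open>
  Put \<open>L s = log 2 (E (W^s))\<close> and \<open>F s = s - L s\<close>, so that \<open>s1 d\<close> solves \<open>F s = d\<close>. Jensen's inequality
  under the law weighted by \<open>W\<close> gives \<open>L s \<ge> - (1 - s) c\<close> with \<open>c = E (W log W) < 1\<close>, and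
  convexity of \<open>L\<close> together with \<open>L 1 = 0\<close> turns this into
  \<open>F t - F s \<ge> (1 - c) (t - s)\<close>; hence \<open>F\<close> is an increasing bijection of the unit interval and
  \<open>s1 d \<le> d / (1 - c)\<close> tends to \<open>0\<close>. Finally \<open>L s / s\<close> tends to \<open>E (log W)\<close> as \<open>s\<close> tends to \<open>0\<close>
  (from below by Jensen, from above by \<open>ln x \<le> x - 1\<close> and dominated convergence), so
  \<open>s1 d / s2 d = (1 - E (log W)) / (1 - L s / s)\<close> at \<open>s = s1 d\<close> tends to \<open>1\<close>.
\<close>

section \<open>Exponential inequalities\<close>

lemma exp_weighted_Jensen:
  fixes w X :: "'a \<Rightarrow> real"
  assumes w: "AE x in M. 0 \<le> w x" "integrable M w" "(\<integral>x. w x \<partial>M) = 1"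
    and X: "integrable M (\<lambda>x. w x * X x)" "integrable M (\<lambda>x. w x * exp (X x))"
  shows "exp (\<integral>x. w x * X x \<partial>M) \<le> (\<integral>x. w x * exp (X x) \<partial>M)"
proof -
  define a where "a = (\<integral>x. w x * X x \<partial>M)"
  \<comment> \<open>The right-hand integrand is \<open>w x\<close> times the tangent line to the
    exponential at \<open>a\<close>. Since \<open>w\<close> has mass one and \<open>a\<close> is the
    weighted mean, the linear term integrates to zero.\<close>
  have "exp a = (\<integral>x. exp a * (w x + w x * X x - a * w x) \<partial>M)"
    using w X by (simp add: a_def)
  also have "\<dots> \<le> (\<integral>x. w x * exp (X x) \<partial>M)"
  proof (rule integral_mono_AE)
    show "AE x in M. exp a * (w x + w x * X x - a * w x) \<le> w x * exp (X x)"
      using w(1)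
    proof eventually_elim
      case (elim x)
      have "exp a * (1 + (X x - a)) \<le> exp a * exp (X x - a)"
        by (intro mult_left_mono exp_ge_add_one_self) simp
      then have "exp a * (1 + (X x - a)) \<le> exp (X x)"
        by (simp flip: exp_add)
      then have "w x * (exp a * (1 + (X x - a))) \<le> w x * exp (X x)"
        using elim by (rule mult_left_mono)
      then show ?case by (simp add: algebra_simps)
    qed
  qed (use w X in auto)
  finally show ?thesis by (simp add: a_def)
qed

text \<open>The product \<open>s * y\<close> lies between 0 and \<open>y\<close>, hence is at most
  the larger of the two. The bound is free of \<open>s\<close>, so with \<open>y = ln (W x)\<close>
  it makes \<open>1 + W x\<close> dominate all the powers at once.\<close>

lemma exp_mult_le_add_exp:
  fixes s y :: real
  assumes "0 \<le> s" "s \<le> 1"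
  shows "exp (s * y) \<le> 1 + exp y"
proof -
  have "s * y \<le> max 0 y"
    using assms mult_left_le_one_le[of y s] mult_nonneg_nonpos[of s y] by linarith
  then have "exp (s * y) \<le> exp (max 0 y)" by simp
  also have "\<dots> \<le> 1 + exp y" by (auto simp: max_def add_increasing add_increasing2)
  finally show ?thesis .
qed

text \<open>The tangent at 0 bounds the quotient below by \<open>y\<close>, and convexity bounds it
  above by its value at \<open>s = 1\<close>. This supplies the dominating function for
  differentiating \<open>m\<close> at 0.\<close>

lemma exp_difference_quotient_bound:
  fixes s y :: real
  assumes "0 < s" "s \<le> 1"
  shows "\<bar>(exp (s * y) - 1) / s\<bar> \<le> \<bar>y\<bar> + exp y"
proof -
  have "y \<le> (exp (s * y) - 1) / s"
    using exp_ge_add_one_self[of "s * y"] assms by (simp add: field_simps)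
  moreover have "(exp (s * y) - 1) / s \<le> exp y - 1"
  proof -
    have "exp ((1 - s) *\<^sub>R 0 + s *\<^sub>R y) \<le> (1 - s) * exp 0 + s * exp y"
      using assms by (intro convex_onD[OF exp_convex]) auto
    then show ?thesis using assms by (simp add: field_simps)
  qed
  ultimately show ?thesis
    by (smt (verit) exp_gt_zero)
qed

section \<open>Moments of a positive variable of mean one\<close>

locale positive_mean_one_variable = prob_space M for M :: "'a measure" +
  fixes W :: "'a \<Rightarrow> real"
  assumes measurable_W [measurable]: "W \<in> borel_measurable M"
    and pos: "AE x in M. W x > 0"
    and integrable_W: "integrable M W"
    and mean: "(\<integral>x. W x \<partial>M) = 1"
    and integrable_log: "integrable M (\<lambda>x. log 2 (W x))"
begin

definition m :: "real \<Rightarrow> real" where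
  "m s = (\<integral>x. W x powr s \<partial>M)"

lemma integrable_ln: "integrable M (\<lambda>x. ln (W x))"
proof -
  have "integrable M (\<lambda>x. ln 2 * log 2 (W x))" using integrable_log by simp
  then show ?thesis by (simp add: log_def)
qed

lemma expectation_log: "(\<integral>x. log 2 (W x) \<partial>M) = (\<integral>x. ln (W x) \<partial>M) / ln 2"
  by (simp add: log_def)

lemma AE_powr_bound:
  assumes "0 \<le> s" "s \<le> 1"
  shows "AE x in M. norm (W x powr s) \<le> 1 + W x"
  using pos
proof eventually_elim
  case (elim x)
  then show ?case
    using exp_mult_le_add_exp[OF assms, of "ln (W x)"] by (simp add: powr_def)
qed

lemma integrable_powr:
  assumes "0 \<le> s" "s \<le> 1"
  shows "integrable M (\<lambda>x. W x powr s)"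
proof (rule Bochner_Integration.integrable_bound)
  show "integrable M (\<lambda>x. 1 + W x)" using integrable_W by simp
  show "AE x in M. norm (W x powr s) \<le> norm (1 + W x)"
    using AE_powr_bound[OF assms] by eventually_elim auto
qed measurable

lemma m_0: "m 0 = 1"
proof -
  have "m 0 = (\<integral>x. 1 \<partial>M)"
    unfolding m_def by (rule integral_cong_AE) (use pos in \<open>auto elim!: eventually_mono\<close>)
  then show ?thesis by (simp add: prob_space)
qed

lemma m_1: "m 1 = 1"
proof -
  have "m 1 = (\<integral>x. W x \<partial>M)"
    unfolding m_def by (rule integral_cong_AE) (use pos in \<open>auto elim!: eventually_mono\<close>)
  then show ?thesis by (simp add: mean)
qed

text \<open>Jensen with the constant weight 1. It yields positivity of \<open>m\<close>, the sign of
  the mean of \<open>ln W\<close> (at \<open>s = 1\<close>), and the lower half of the limit of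
  \<open>log 2 (m s) / s\<close>.\<close>

lemma exp_le_m:
  assumes "0 \<le> s" "s \<le> 1"
  shows "exp (s * (\<integral>x. ln (W x) \<partial>M)) \<le> m s"
proof -
  have eq: "AE x in M. exp (s * ln (W x)) = W x powr s"
    using pos by eventually_elim (simp add: powr_def)
  have "integrable M (\<lambda>x. exp (s * ln (W x)))"
    using integrable_powr[OF assms] by (subst integrable_cong_AE[OF _ _ eq]) auto
  then have "exp (\<integral>x. 1 * (s * ln (W x)) \<partial>M) \<le> (\<integral>x. 1 * exp (s * ln (W x)) \<partial>M)"
    using integrable_ln by (intro exp_weighted_Jensen) (auto simp: prob_space)
  moreover have "(\<integral>x. exp (s * ln (W x)) \<partial>M) = m s"
    unfolding m_def by (rule integral_cong_AE[OF _ _ eq]) auto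
  ultimately show ?thesis by simp
qed

lemma m_pos:
  assumes "0 \<le> s" "s \<le> 1"
  shows "0 < m s"
  by (rule less_le_trans[OF exp_gt_zero exp_le_m[OF assms]])

text \<open>This is log-convexity of the moments between \<open>s\<close> and 1, using
  \<open>m 1 = 1\<close>. As in the proof of Hoelder's inequality, weighted AM-GM is applied
  pointwise to \<open>W powr s / m s\<close> and \<open>W\<close>, both of mean one.\<close>

lemma m_powr_interpolation:
  assumes st: "0 \<le> s" "s \<le> t" "t \<le> 1" "s < 1"
  shows "m t \<le> m s powr ((1 - t) / (1 - s))"
proof -
  \<comment> \<open>The weight that makes \<open>t\<close> the convex combination of
    \<open>s\<close> and 1.\<close>
  define l where "l = (t - s) / (1 - s)"
  have l: "0 \<le> l" "l \<le> 1" using st by (auto simp: l_def field_simps)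
  have l1: "(1 - t) / (1 - s) = 1 - l" using st by (simp add: l_def field_simps)
  have "l * (1 - s) = t - s" using st by (simp add: l_def)
  then have t: "t = (1 - l) * s + l" by (simp add: algebra_simps)
  have ms: "0 < m s" using st by (intro m_pos) auto
  have "m t / m s powr (1 - l) = (\<integral>x. W x powr t / m s powr (1 - l) \<partial>M)"
    by (simp add: m_def)
  also have "\<dots> \<le> (\<integral>x. (1 - l) * (W x powr s / m s) + l * W x \<partial>M)"
  proof (rule integral_mono_AE)
    show "AE x in M. W x powr t / m s powr (1 - l) \<le> (1 - l) * (W x powr s / m s) + l * W x"
      using pos
    proof eventually_elim
      case (elim x)
      have "W x powr t / m s powr (1 - l) = (W x powr s / m s) powr (1 - l) * W x powr l"
        using elim ms by (subst t) (simp add: powr_divide powr_powr powr_add mult.commute)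
      also have "\<dots> = exp ((1 - l) *\<^sub>R ln (W x powr s / m s) + l *\<^sub>R ln (W x))"
        using elim ms by (simp add: powr_def exp_add)
      also have "\<dots> \<le> (1 - l) * exp (ln (W x powr s / m s)) + l * exp (ln (W x))"
        using l by (intro convex_onD[OF exp_convex]) auto
      also have "\<dots> = (1 - l) * (W x powr s / m s) + l * W x"
        using elim ms by simp
      finally show ?case .
    qed
  qed (use st integrable_powr integrable_W in auto)
  also have "\<dots> = (1 - l) * (m s / m s) + l"
    using st integrable_powr[of s] integrable_W by (simp add: m_def mean)
  also have "\<dots> = 1" using ms by simp
  finally show ?thesis using ms by (simp add: l1 field_simps)
qed

text \<open>Keeps the denominator of \<open>s2\<close> at least 1, so that divisions by it are
  legitimate.\<close>

lemma expectation_ln_nonpos: "(\<integral>x. ln (W x) \<partial>M) \<le> 0"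
  using exp_le_m[of 1] m_1 by simp

section \<open>Continuity of the moments and their slope at 0\<close>

lemma continuous_on_m: "continuous_on {0..1} m"
  unfolding continuous_on_sequentially
proof (intro ballI allI impI, elim conjE)
  fix u :: "nat \<Rightarrow> real" and s
  assume s: "s \<in> {0..1}" and u: "\<forall>n. u n \<in> {0..1}" "u \<longlonglongrightarrow> s"
  show "(m \<circ> u) \<longlonglongrightarrow> m s"
    unfolding m_def comp_def
  proof (rule integral_dominated_convergence)
    show "integrable M (\<lambda>x. 1 + W x)" using integrable_W by simp
    show "AE x in M. (\<lambda>n. W x powr u n) \<longlonglongrightarrow> W x powr s"
      using pos by eventually_elim (use u in \<open>auto intro!: tendsto_intros\<close>)
    show "AE x in M. norm (W x powr u n) \<le> 1 + W x" for n
      using u by (intro AE_powr_bound) auto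
  qed measurable
qed

lemma m_right_derivative_at_0:
  "((\<lambda>s. (m s - 1) / s) \<longlongrightarrow> (\<integral>x. ln (W x) \<partial>M)) (at_right 0)"
\<comment> \<open>Dominated convergence works along sequences; \<open>b = 1\<close> keeps the
  exponents below 1, where the bound on the difference quotient holds.\<close>
proof (rule tendsto_at_right_sequentially[where b = 1])
  fix u :: "nat \<Rightarrow> real"
  assume u: "\<And>n. 0 < u n" "\<And>n. u n < 1" "u \<longlonglongrightarrow> 0"
  have "(\<lambda>n. \<integral>x. (W x powr u n - 1) / u n \<partial>M) \<longlonglongrightarrow> (\<integral>x. ln (W x) \<partial>M)"
  proof (rule integral_dominated_convergence)
    show "integrable M (\<lambda>x. \<bar>ln (W x)\<bar> + W x)" using integrable_W integrable_ln by simp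
    show "AE x in M. (\<lambda>n. (W x powr u n - 1) / u n) \<longlonglongrightarrow> ln (W x)"
      using pos
    proof eventually_elim
      case (elim x)
      have "((\<lambda>s. W x powr s) has_real_derivative ln (W x)) (at 0)"
        using elim by (auto intro!: derivative_eq_intros)
      then have "((\<lambda>s. (W x powr s - 1) / s) \<longlongrightarrow> ln (W x)) (at 0)"
        using elim by (simp add: DERIV_def)
      moreover have "filterlim u (at 0) sequentially"
        using u(3) less_imp_neq[OF u(1), THEN not_sym] by (simp add: filterlim_at)
      ultimately show ?case by (rule filterlim_compose)
    qed
    show "AE x in M. norm ((W x powr u n - 1) / u n) \<le> \<bar>ln (W x)\<bar> + W x" for n
      using pos
    proof eventually_elim
      case (elim x)
      then show ?case
        using exp_difference_quotient_bound[of "u n" "ln (W x)"] u(1,2)[of n]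
        by (simp add: powr_def)
    qed
  qed measurable
  moreover have "(\<integral>x. (W x powr u n - 1) / u n \<partial>M) = (m (u n) - 1) / u n" for n
    using integrable_powr[of "u n"] u(1,2)[of n] by (simp add: m_def prob_space)
  ultimately show "(\<lambda>n. (m (u n) - 1) / u n) \<longlonglongrightarrow> (\<integral>x. ln (W x) \<partial>M)"
    by (simp only:)
qed simp

lemma log_m_right_derivative_at_0:
  "((\<lambda>s. log 2 (m s) / s) \<longlongrightarrow> (\<integral>x. log 2 (W x) \<partial>M)) (at_right 0)"
proof (rule tendsto_sandwich)
  have unit: "\<forall>\<^sub>F s in at_right 0. s \<in> {0<..<1::real}"
    by (rule eventually_at_right_real) simp
  show "\<forall>\<^sub>F s in at_right 0. (\<integral>x. log 2 (W x) \<partial>M) \<le> log 2 (m s) / s"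
    using unit
  proof eventually_elim
    case (elim s)
    then have "s * (\<integral>x. ln (W x) \<partial>M) \<le> ln (m s)"
      using exp_le_m[of s] m_pos[of s] by (simp add: ln_ge_iff)
    then show ?case
      using elim by (simp add: expectation_log log_def field_simps)
  qed
  show "\<forall>\<^sub>F s in at_right 0. log 2 (m s) / s \<le> (m s - 1) / s / ln 2"
    using unit
  proof eventually_elim
    case (elim s)
    then have "ln (m s) \<le> m s - 1"
      using m_pos[of s] by (intro ln_le_minus_one) auto
    then show ?case
      using elim by (simp add: log_def field_simps)
  qed
  show "((\<lambda>s. (m s - 1) / s / ln 2) \<longlongrightarrow> (\<integral>x. log 2 (W x) \<partial>M)) (at_right 0)"
    unfolding expectation_log by (intro tendsto_divide m_right_derivative_at_0) auto
qed simp

text \<open>The base 2 logarithm of \<open>2 powr s / m s\<close> on the unit interval, which makes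
  the equation defining \<open>s1\<close> additive.\<close>

definition F :: "real \<Rightarrow> real" where
  "F s = s - log 2 (m s)"

lemma powr_eq_iff_F:
  assumes "s \<in> {0..1}"
  shows "2 powr d = 2 powr s / (\<integral>x. W x powr s \<partial>M) \<longleftrightarrow> d = F s"
proof -
  have "2 powr F s = 2 powr s / m s"
    using m_pos[of s] assms by (simp add: F_def powr_diff)
  then show ?thesis
    using powr_inj[of 2 d "F s"] by (simp add: m_def)
qed

lemma continuous_on_F: "continuous_on {0..1} F"
  unfolding F_def
  using m_pos by (intro continuous_on_diff continuous_on_id continuous_on_log
    continuous_on_const continuous_on_m) (auto simp: less_imp_neq[THEN not_sym])

end

section \<open>Strict monotonicity from subcriticality\<close>

locale subcritical_variable = positive_mean_one_variable +
  assumes integrable_W_log: "integrable M (\<lambda>x. W x * log 2 (W x))"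
    and subcritical: "(\<integral>x. W x * log 2 (W x) \<partial>M) < 1"
begin

definition c :: real where
  "c = (\<integral>x. W x * log 2 (W x) \<partial>M)"

text \<open>Splitting \<open>W powr s\<close> as \<open>W * W powr (s - 1)\<close> turns the first
  factor into a probability density, under which \<open>log 2 W\<close> has mean \<open>c\<close>;
  Jensen then applies to the second factor.\<close>

lemma log_m_lower_bound:
  assumes s: "0 \<le> s" "s \<le> 1"
  shows "(s - 1) * c \<le> log 2 (m s)"
proof -
  have eq: "AE x in M. W x * exp ((s - 1) * ln 2 * log 2 (W x)) = W x powr s"
    using pos
  proof eventually_elim
    case (elim x)
    then have "W x * W x powr (s - 1) = W x powr s"
      by (simp add: powr_mult_base)
    with elim show ?case by (simp add: powr_def log_def)
  qed
  have "integrable M (\<lambda>x. W x * exp ((s - 1) * ln 2 * log 2 (W x)))"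
    using integrable_powr[OF s] by (subst integrable_cong_AE[OF _ _ eq]) auto
  moreover have "integrable M (\<lambda>x. W x * ((s - 1) * ln 2 * log 2 (W x)))"
    using integrable_mult_right[OF integrable_W_log, of "(s - 1) * ln 2"]
    by (simp add: mult_ac)
  moreover have "AE x in M. 0 \<le> W x" using pos by eventually_elim simp
  ultimately have "exp (\<integral>x. W x * ((s - 1) * ln 2 * log 2 (W x)) \<partial>M)
      \<le> (\<integral>x. W x * exp ((s - 1) * ln 2 * log 2 (W x)) \<partial>M)"
    using integrable_W mean by (intro exp_weighted_Jensen)
  also have "\<dots> = m s"
    unfolding m_def by (rule integral_cong_AE[OF _ _ eq]) auto
  also have "(\<integral>x. W x * ((s - 1) * ln 2 * log 2 (W x)) \<partial>M) = (s - 1) * ln 2 * c"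
    unfolding c_def by (subst integral_mult_right_zero[symmetric]) (simp add: mult_ac)
  finally have "(s - 1) * ln 2 * c \<le> ln (m s)"
    using m_pos[OF s] by (simp add: ln_ge_iff)
  then show ?thesis by (simp add: log_def field_simps)
qed

text \<open>Interpolation towards 1 bounds the increase of \<open>log 2 (m s)\<close> by a multiple
  of \<open>- log 2 (m s)\<close>, and the lower bound \<open>(s - 1) * c\<close> cancels the
  denominator \<open>1 - s\<close>.\<close>

lemma F_expansion:
  assumes st: "0 \<le> s" "s \<le> t" "t \<le> 1"
  shows "(1 - c) * (t - s) \<le> F t - F s"
\<comment> \<open>The interpolation divides by \<open>1 - s\<close>; if \<open>s = 1\<close> then
  also \<open>t = 1\<close> and both sides vanish.\<close>
proof (cases "s = 1")
  case False
  with st have s: "s < 1" by simp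
  have pos: "0 < m s" "0 < m t" using st by (auto intro!: m_pos)
  have "log 2 (m t) \<le> log 2 (m s powr ((1 - t) / (1 - s)))"
    using m_powr_interpolation[OF st s] pos by simp
  also have "\<dots> = log 2 (m s) - (t - s) / (1 - s) * log 2 (m s)"
    using pos s by (simp add: log_powr field_simps)
  finally have "F t - F s \<ge> (t - s) + (t - s) / (1 - s) * log 2 (m s)"
    by (simp add: F_def)
  moreover have "(t - s) / (1 - s) * ((s - 1) * c) \<le> (t - s) / (1 - s) * log 2 (m s)"
    using st s by (intro mult_left_mono log_m_lower_bound) auto
  moreover have "(t - s) / (1 - s) * ((s - 1) * c) = - (t - s) * c"
    using s by (simp add: field_simps)
  ultimately show ?thesis by (simp add: algebra_simps)
qed (use st in simp)

lemma F_inj: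
  assumes "s \<in> {0..1}" "t \<in> {0..1}" "F s = F t"
  shows "s = t"
proof -
  have *: "t \<le> s" if "s \<in> {0..1}" "t \<in> {0..1}" "F s = F t" for s t
  proof (rule ccontr)
    assume "\<not> t \<le> s"
    then have "0 < (1 - c) * (t - s)" using subcritical by (simp add: c_def)
    with F_expansion[of s t] that \<open>\<not> t \<le> s\<close> show False by simp
  qed
  show ?thesis using *[of s t] *[of t s] assms by simp
qed

text \<open>Intermediate value theorem: \<open>m 0 = m 1 = 1\<close> gives \<open>F 0 = 0\<close>
  and \<open>F 1 = 1\<close>.\<close>

lemma F_surj:
  assumes "0 < d" "d < 1"
  shows "\<exists>s\<in>{0..1}. F s = d"
  using IVT'[of F 0 d 1] continuous_on_F assms m_0 m_1 by (auto simp: F_def)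

lemma ex1_F:
  assumes "0 < d" "d < 1"
  shows "\<exists>!s. s \<in> {0..1} \<and> 2 powr d = 2 powr s / (\<integral>x. W x powr s \<partial>M)"
proof -
  obtain s where s: "s \<in> {0..1}" "F s = d" using F_surj[OF assms] by blast
  show ?thesis
  proof (rule ex1I[of _ s], intro conjI)
    show "s \<in> {0..1}" by fact
    show "2 powr d = 2 powr s / (\<integral>x. W x powr s \<partial>M)"
      by (rule iffD2[OF powr_eq_iff_F[OF s(1)] s(2)[symmetric]])
  next
    fix t assume t: "t \<in> {0..1} \<and> 2 powr d = 2 powr t / (\<integral>x. W x powr t \<partial>M)"
    have "d = F t"
      by (rule iffD1[OF powr_eq_iff_F[OF conjunct1[OF t]] conjunct2[OF t]])
    then show "t = s"
      by (rule F_inj[OF s(1) conjunct1[OF t] trans[OF s(2)], symmetric])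
  qed
qed

section \<open>Behaviour of \<open>s1\<close> near 0\<close>

lemma s1_solves:
  assumes "0 < d" "d < 1"
  shows "s1 M W d \<in> {0..1}" "F (s1 M W d) = d"
proof -
  have *: "s1 M W d \<in> {0..1} \<and>
      2 powr d = 2 powr s1 M W d / (\<integral>x. W x powr s1 M W d \<partial>M)"
    unfolding s1_def by (rule theI'[OF ex1_F[OF assms]])
  show "s1 M W d \<in> {0..1}" by (rule conjunct1[OF *])
  show "F (s1 M W d) = d"
    by (rule iffD1[OF powr_eq_iff_F[OF conjunct1[OF *]] conjunct2[OF *], symmetric])
qed

lemma s1_pos:
  assumes "0 < d" "d < 1"
  shows "0 < s1 M W d"
  using s1_solves[OF assms] assms m_0 by (cases "s1 M W d = 0") (auto simp: F_def)

lemma s1_upper_bound: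
  assumes "0 < d" "d < 1"
  shows "s1 M W d \<le> d / (1 - c)"
  using F_expansion[of 0 "s1 M W d"] s1_solves[OF assms] subcritical m_0
  by (simp add: c_def F_def field_simps)

text \<open>Convergence from the right, not merely to 0, is what allows composition with the
  one-sided limit of \<open>log 2 (m s) / s\<close>.\<close>

lemma s1_at_right_0: "filterlim (s1 M W) (at_right 0) (at_right 0)"
proof -
  have unit: "\<forall>\<^sub>F d in at_right 0. d \<in> {0<..<1::real}"
    by (rule eventually_at_right_real) simp
  have pos: "\<forall>\<^sub>F d in at_right 0. 0 < s1 M W d"
    using unit by eventually_elim (auto intro: s1_pos)
  have "(s1 M W \<longlongrightarrow> 0) (at_right 0)"
  proof (rule tendsto_sandwich)
    show "\<forall>\<^sub>F d in at_right 0. 0 \<le> s1 M W d"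
      using pos by eventually_elim simp
    show "\<forall>\<^sub>F d in at_right 0. s1 M W d \<le> d / (1 - c)"
      using unit by eventually_elim (auto intro: s1_upper_bound)
    show "((\<lambda>d. d / (1 - c)) \<longlongrightarrow> 0) (at_right 0)"
      using subcritical by (auto simp: c_def intro!: tendsto_eq_intros)
  qed simp
  then show ?thesis
    using pos by (auto simp: filterlim_at elim!: eventually_mono)
qed

lemma s1_over_s2: "((\<lambda>d. s1 M W d / s2 M W d) \<longlongrightarrow> 1) (at_right 0)"
proof -
  define e where "e = (\<integral>x. log 2 (W x) \<partial>M)"
  have e: "e \<le> 0"
    using expectation_ln_nonpos by (simp add: e_def expectation_log divide_nonpos_pos)
  have "((\<lambda>d. log 2 (m (s1 M W d)) / s1 M W d) \<longlongrightarrow> e) (at_right 0)"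
    unfolding e_def by (rule filterlim_compose[OF log_m_right_derivative_at_0 s1_at_right_0])
  then have "((\<lambda>d. (1 - e) / (1 - log 2 (m (s1 M W d)) / s1 M W d)) \<longlongrightarrow> (1 - e) / (1 - e))
      (at_right 0)"
    using e by (intro tendsto_intros) auto
  then have "((\<lambda>d. (1 - e) / (1 - log 2 (m (s1 M W d)) / s1 M W d)) \<longlongrightarrow> 1) (at_right 0)"
    using e by simp
  moreover have "\<forall>\<^sub>F d in at_right 0. d \<in> {0<..<1::real}"
    by (rule eventually_at_right_real) simp
  then have "\<forall>\<^sub>F d in at_right 0. (1 - e) / (1 - log 2 (m (s1 M W d)) / s1 M W d)
      = s1 M W d / s2 M W d"
  proof eventually_elim
    case (elim d)
    then have s: "0 < s1 M W d" and "F (s1 M W d) = d"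
      using s1_pos s1_solves(2) by auto
    \<comment> \<open>The equation \<open>F (s1 M W d) = d\<close> divided by the positive number
      \<open>s1 M W d\<close>; the factor \<open>d\<close> then cancels against the one in
      \<open>s2\<close>.\<close>
    then have "1 - log 2 (m (s1 M W d)) / s1 M W d = d / s1 M W d"
      by (simp add: F_def field_simps)
    then show ?case by (simp add: s2_def e_def)
  qed
  ultimately show ?thesis by (rule Lim_transform_eventually)
qed

end

theorem proposition1p7:
  fixes M :: "'a measure" and W :: "'a \<Rightarrow> real"
  assumes "prob_space M"
    and "W \<in> borel_measurable M"
    and "AE x in M. W x > 0"
    and "\<not> (\<exists>c. AE x in M. W x = c)"
    and "integrable M W" and "(\<integral>x. W x \<partial>M) = 1"
    and "integrable M (\<lambda>x. W x * log 2 (W x))"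
    and "(\<integral>x. W x * log 2 (W x) \<partial>M) < 1"
    and "integrable M (\<lambda>x. log 2 (W x))"
  shows "(\<forall>d\<in>{0<..<1}.
            (\<exists>!s. s \<in> {0..1} \<and> 2 powr d = 2 powr s / (\<integral>x. W x powr s \<partial>M)) \<and>
            (\<forall>s\<in>{0..1}. 2 powr d = 2 powr s / (\<integral>x. W x powr s \<partial>M) \<longleftrightarrow>
               d = s - log 2 (\<integral>x. W x powr s \<partial>M)) \<and>
            (\<forall>s. s = d / (1 - (\<integral>x. log 2 (W x) \<partial>M)) \<longleftrightarrow>
               d = s - (\<integral>x. log 2 (W x powr s) \<partial>M))) \<and>
         ((\<lambda>d. s1 M W d / s2 M W d) \<longlongrightarrow> 1) (at_right 0)"
proof -
  interpret prob_space M by fact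
  interpret subcritical_variable M W
    using assms by unfold_locales auto
  have log_powr_mean: "(\<integral>x. log 2 (W x powr s) \<partial>M) = s * (\<integral>x. log 2 (W x) \<partial>M)" for s
  proof -
    have "(\<integral>x. log 2 (W x powr s) \<partial>M) = (\<integral>x. s * log 2 (W x) \<partial>M)"
      by (rule integral_cong_AE) (use pos in \<open>auto simp: log_powr elim!: eventually_mono\<close>)
    then show ?thesis by simp
  qed
  \<comment> \<open>Ensures a nonzero denominator, so the two forms of the equation for
    \<open>s2\<close> differ only by a division.\<close>
  have "(\<integral>x. log 2 (W x) \<partial>M) \<le> 0"
    using expectation_ln_nonpos by (simp add: expectation_log divide_nonpos_pos)
  then have "s = d / (1 - (\<integral>x. log 2 (W x) \<partial>M)) \<longleftrightarrow> d = s - (\<integral>x. log 2 (W x powr s) \<partial>M)"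
    for s d
    unfolding log_powr_mean by (auto simp: field_simps)
  moreover have "2 powr d = 2 powr s / (\<integral>x. W x powr s \<partial>M) \<longleftrightarrow>
      d = s - log 2 (\<integral>x. W x powr s \<partial>M)" if "s \<in> {0..1}" for s d
    using powr_eq_iff_F[OF that] by (simp add: F_def m_def)
  ultimately show ?thesis
    using ex1_F s1_over_s2 by auto
qed

end
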